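(* Let $\psi$ and $\varphi$ be analytic functions on the open unit disk $\mathbb{D}$ with $\varphi(\mathbb{D})\subseteq\mathbb{D}$, and for a function $f$ analytic on $\mathbb{D}$ put $W_{\psi,\varphi}f=\psi\cdot(f\circ\varphi)$. Suppose that $X$ is a set of functions analytic on $\mathbb{D}$ such that (i) $W_{\psi,\varphi}$ maps $X$ to $X$; (ii) $X$ contains a nonzero constant function; (iii) $X$ contains a function of the form $z\mapsto z+c$ for some constant $c\in\mathbb{C}$; and (iv) there is a dense subset $S$ of the unit circle $\partial\mathbb{D}$ such that for each point in $S$ there is a function in $X$ that does not extend analytically to a neighborhood of that point. If $W_{\psi,\varphi}:X\to X$ is invertible, then $\varphi$ is an automorphism of $\mathbb{D}$.
   Context: $\mathbb{D}=\{z\in\mathbb{C}:|z|<1\}$. The set $X$ is only a set of analytic functions on $\mathbb{D}$; it is not assumed to have any linear or norm structure. "Invertible" means that the map $W_{\psi,\varphi}:X\to X$ is a bijection. A function $f$ analytic on $\mathbb{D}$ extends analytically to a neighborhood of $\zeta\in\partial\mathbb{D}$ if there are an open disk $U$ centered at $\zeta$ and an analytic function on $\mathbb{D}\cup U$ that agrees with $f$ on $\mathbb{D}$. An automorphism of $\mathbb{D}$ is an analytic bijection of $\mathbb{D}$ onto $\mathbb{D}$. *)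

theory Defs
  imports "HOL-Complex_Analysis.Complex_Analysis" "HOL-Library.FuncSet"
begin

abbreviation unit_disk :: "complex set" where
  "unit_disk \<equiv> ball 0 1"

text \<open>
  A function on the disk is represented by the unique total function that agrees with it on
  the disk and is \<^const>\<open>undefined\<close> outside. Thus equality of elements of
  \<open>analytic_functions\<close> is equality of functions on the disk, and
  injectivity on a subset has its usual meaning.
\<close>

definition analytic_functions :: "(complex \<Rightarrow> complex) set" where
  "analytic_functions = {f \<in> extensional unit_disk. f analytic_on unit_disk}"

definition weighted_comp ::
    "(complex \<Rightarrow> complex) \<Rightarrow> (complex \<Rightarrow> complex) \<Rightarrow> (complex \<Rightarrow> complex) \<Rightarrow> (complex \<Rightarrow> complex)" where
  "weighted_comp \<psi> \<phi> f = (\<lambda>z\<in>unit_disk. \<psi> z * f (\<phi> z))"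

definition extends_analytically_near :: "(complex \<Rightarrow> complex) \<Rightarrow> complex \<Rightarrow> bool" where
  "extends_analytically_near f \<zeta> \<longleftrightarrow>
     (\<exists>r>0. \<exists>g. g analytic_on (unit_disk \<union> ball \<zeta> r) \<and> (\<forall>z\<in>unit_disk. g z = f z))"

definition disk_automorphism :: "(complex \<Rightarrow> complex) \<Rightarrow> bool" where
  "disk_automorphism \<phi> \<longleftrightarrow> \<phi> analytic_on unit_disk \<and> bij_betw \<phi> unit_disk unit_disk"

end

theory Submission
  imports Defs
begin

text \<open>
  Since \<open>W = weighted_comp \<psi> \<phi>\<close> is onto \<open>X\<close>, there are \<open>f1\<close> and \<open>f2\<close> in \<open>X\<close> with
  \<open>\<psi> \<cdot> (f1 \<circ> \<phi>) = a \<noteq> 0\<close> and \<open>\<psi> \<cdot> (f2 \<circ> \<phi>) = z + c\<close>. Dividing, \<open>h = (a f2 - c f1) / f1\<close> is a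
  meromorphic function on the whole disk that is a left inverse of \<open>\<phi>\<close>. So \<open>\<phi>\<close> is injective,
  and what has to be excluded is that the image \<open>G\<close> of \<open>\<phi>\<close> is a proper subset of the disk.

  Suppose it is. Then \<open>G\<close> has a boundary point inside the disk, and as \<open>G\<close> is simply connected,
  its boundary points are not isolated. Hence some boundary point \<open>p\<close> in the disk avoids the
  discrete set on which \<open>f1\<close> vanishes or \<open>h\<close> is not locally invertible. The value \<open>\<zeta> = h p\<close> lies
  on the unit circle, and the local inverse \<open>k\<close> of \<open>h\<close> near \<open>\<zeta>\<close> continues \<open>\<phi>\<close> analytically across
  an arc around \<open>\<zeta>\<close>, with values inside the disk and away from the zeros of \<open>f1\<close>
  (lemma \<open>analytic_continuation_if_not_onto_disk\<close>).

  Now every \<open>f\<close> in \<open>X\<close> is \<open>W g = \<psi> \<cdot> (g \<circ> \<phi>) = a (g \<circ> \<phi>) / (f1 \<circ> \<phi>)\<close> for some \<open>g\<close> in \<open>X\<close>, so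
  \<open>a (g \<circ> k) / (f1 \<circ> k)\<close> continues \<open>f\<close> across that same arc. The arc contains a point of the
  dense set \<open>S\<close>, at which some member of \<open>X\<close> cannot be continued, a contradiction.
\<close>

section \<open>Boundary points of the image\<close>

text \<open>
  If \<open>p\<close> were isolated in the frontier, then a punctured disk around \<open>p\<close>, being connected, would
  lie in \<open>G\<close>, and a small circle around \<open>p\<close> would be a loop in \<open>G\<close> with winding number 1 about a
  point outside \<open>G\<close>.
\<close>

lemma islimpt_frontier_simply_connected:
  fixes G :: "complex set"
  assumes "open G" "simply_connected G" and p: "p \<in> frontier G"
  shows "p islimpt frontier G"
proof (rule ccontr)
  assume "\<not> p islimpt frontier G"
  then obtain r where r: "r > 0" "\<And>q. q \<in> frontier G \<Longrightarrow> dist q p < r \<Longrightarrow> q = p"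
    unfolding islimpt_approachable by blast
  have pG: "p \<notin> G" "p \<in> closure G"
    using p \<open>open G\<close> by (auto simp: frontier_def interior_open)
  define A where "A = ball p r - {p}"
  have "connected A"
    unfolding A_def by (rule connected_punctured_ball) simp
  moreover have "A \<inter> G \<noteq> {}"
    using pG r(1) closure_approachable[of p G] by (force simp: A_def dist_commute)
  moreover have "A \<inter> frontier G = {}"
    using r(2) by (auto simp: A_def dist_commute)
  ultimately have AG: "A \<subseteq> G"
    using connected_Int_frontier by blast
  have "path_image (circlepath p (r / 2)) \<subseteq> A"
    using r(1) by (auto simp: A_def dist_norm norm_minus_commute)
  with AG have "winding_number (circlepath p (r / 2)) p = 0"
    using pG by (intro simply_connected_imp_winding_number_zero[OF assms(2)]) auto
  with winding_number_circlepath_centre[of "r / 2" p] r(1) show False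
    by simp
qed

text \<open>
  If points \<open>f (z n)\<close> tend to a boundary point \<open>p\<close> of the image, then \<open>z n = h (f (z n))\<close> tends to
  \<open>h p\<close>. This limit is not in \<open>A\<close>, for otherwise \<open>p = f (h p)\<close> would be in the open image.
\<close>

lemma left_inverse_maps_frontier_to_frontier:
  fixes f h :: "complex \<Rightarrow> complex"
  assumes "open A" "continuous_on A f" "open (f ` A)"
    and p: "p \<in> frontier (f ` A)" and "isCont h p"
    and hf: "\<And>z. z \<in> A \<Longrightarrow> h (f z) = z"
  shows "h p \<in> frontier A"
proof -
  have p': "p \<in> closure (f ` A)" "p \<notin> f ` A"
    using p \<open>open (f ` A)\<close> by (auto simp: frontier_def interior_open)
  then obtain w where w: "\<And>n. w n \<in> f ` A" "w \<longlonglongrightarrow> p"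
    by (auto simp: closure_sequential)
  define z where "z n = h (w n)" for n
  have z: "z n \<in> A" "f (z n) = w n" for n
    using w(1)[of n] hf by (auto simp: z_def)
  have lim: "z \<longlonglongrightarrow> h p"
    unfolding z_def using isCont_tendsto_compose[OF \<open>isCont h p\<close> w(2)] .
  hence "h p \<in> closure A"
    using z(1) by (auto simp: closure_sequential)
  moreover have "h p \<notin> A"
  proof
    assume hp: "h p \<in> A"
    hence "isCont f (h p)"
      using assms(1,2) by (simp add: continuous_on_eq_continuous_at)
    hence "(\<lambda>n. f (z n)) \<longlonglongrightarrow> f (h p)"
      using lim by (rule isCont_tendsto_compose)
    hence "f (h p) = p"
      using w(2) by (simp add: z(2) LIMSEQ_unique)
    with hp p'(2) show False by force
  qed
  ultimately show ?thesis
    using \<open>open A\<close> by (simp add: frontier_def interior_open)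
qed

section \<open>Analytic continuation of a non-surjective map across an arc\<close>

text \<open>
  The quotient \<open>P / Q\<close> is a meromorphic left inverse of \<open>\<phi>\<close>; keeping numerator and denominator
  separate lets its poles and critical points be handled together, as zeros of the single
  holomorphic function \<open>F\<close> in the proof. The requirement on \<open>Q \<circ> k\<close> is what later allows the
  continuation of weighted compositions with the weight \<open>1 / (Q \<circ> \<phi>)\<close>.
\<close>

lemma analytic_continuation_if_not_onto_disk:
  fixes \<phi> P Q :: "complex \<Rightarrow> complex"
  assumes hol: "\<phi> holomorphic_on unit_disk" "P holomorphic_on unit_disk" "Q holomorphic_on unit_disk"
    and sub: "\<phi> ` unit_disk \<subseteq> unit_disk" and ne: "\<phi> ` unit_disk \<noteq> unit_disk"
    and Q: "\<And>z. z \<in> unit_disk \<Longrightarrow> Q (\<phi> z) \<noteq> 0"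
    and P: "\<And>z. z \<in> unit_disk \<Longrightarrow> P (\<phi> z) = z * Q (\<phi> z)"
  obtains \<zeta> \<rho> k where "\<zeta> \<in> sphere 0 1" "\<rho> > 0" "k holomorphic_on ball \<zeta> \<rho>"
    "\<And>z. z \<in> ball \<zeta> \<rho> \<Longrightarrow> k z \<in> unit_disk" "\<And>z. z \<in> ball \<zeta> \<rho> \<Longrightarrow> Q (k z) \<noteq> 0"
    "\<And>z. z \<in> ball \<zeta> \<rho> \<inter> unit_disk \<Longrightarrow> \<phi> z = k z"
proof -
  define G where "G = \<phi> ` unit_disk"
  define h where "h = (\<lambda>w. P w / Q w)"
  define V where "V = {w \<in> unit_disk. Q w \<noteq> 0}"
  define F where "F = (\<lambda>w. Q w * (deriv P w * Q w - P w * deriv Q w))"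
  have h\<phi>: "h (\<phi> z) = z" if "z \<in> unit_disk" for z
    using P[OF that] Q[OF that] by (simp add: h_def)
  have inj: "inj_on \<phi> unit_disk"
    using h\<phi> by (metis inj_onI)
  have cont: "continuous_on unit_disk \<phi>"
    using hol(1) by (rule holomorphic_on_imp_continuous_on)
  have "open G"
    unfolding G_def using hol(1) inj by (intro open_mapping_thm3) auto
  have "unit_disk homeomorphic G"
    unfolding G_def by (rule invariance_of_domain_homeomorphic[OF _ cont _ inj]) auto
  hence "simply_connected G"
    using homeomorphic_simply_connected_eq convex_imp_simply_connected[OF convex_ball] by blast
  have "V = unit_disk \<inter> Q -` (- {0})"
    by (auto simp: V_def)
  hence "open V"
    using continuous_open_preimage[OF holomorphic_on_imp_continuous_on[OF hol(3)] open_ball, of "- {0}"]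
    by (simp add: open_Compl)
  have holh: "h holomorphic_on V"
    unfolding h_def V_def using hol by (intro holomorphic_intros) (auto elim: holomorphic_on_subset)
  have hder: "(h has_field_derivative F w / Q w ^ 3) (at w)" if "w \<in> V" for w
  proof -
    have w: "w \<in> unit_disk" "Q w \<noteq> 0" using that by (auto simp: V_def)
    have dP: "(P has_field_derivative deriv P w) (at w)" and dQ: "(Q has_field_derivative deriv Q w) (at w)"
      using hol w by (auto intro: holomorphic_derivI[of _ unit_disk])
    have "(h has_field_derivative (deriv P w * Q w - P w * deriv Q w) / (Q w * Q w)) (at w)"
      unfolding h_def by (rule DERIV_divide[OF dP dQ w(2)])
    thus ?thesis using w(2) by (simp add: F_def power3_eq_cube)
  qed
  have holF: "F holomorphic_on unit_disk"
    unfolding F_def using hol by (intro holomorphic_intros) auto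
  have \<phi>0: "\<phi> 0 \<in> unit_disk" using sub by force
  \<comment> \<open>By the chain rule for \<open>h \<circ> \<phi> = id\<close>, the derivative of \<open>h\<close> does not vanish on the image.\<close>
  have F0: "F (\<phi> 0) \<noteq> 0"
  proof
    assume "F (\<phi> 0) = 0"
    moreover have "\<phi> 0 \<in> V" using Q[of 0] \<phi>0 by (auto simp: V_def)
    ultimately have "(h has_field_derivative 0) (at (\<phi> 0))"
      using hder[of "\<phi> 0"] by simp
    moreover have "(\<phi> has_field_derivative deriv \<phi> 0) (at 0)"
      using hol(1) by (rule holomorphic_derivI) auto
    ultimately have "((\<lambda>z. h (\<phi> z)) has_field_derivative 0 * deriv \<phi> 0) (at 0)"
      by (rule DERIV_chain2)
    hence "((\<lambda>z. z) has_field_derivative 0 * deriv \<phi> 0) (at (0::complex))"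
      by (rule has_field_derivative_transform_within_open[of _ _ _ unit_disk]) (auto simp: h\<phi>)
    with DERIV_ident[of "at (0::complex)"] show False
      using DERIV_unique by fastforce
  qed
  have "unit_disk \<inter> frontier G \<noteq> {}"
    using sub ne \<phi>0 by (intro connected_Int_frontier) (auto simp: G_def)
  then obtain p0 where p0: "p0 \<in> unit_disk" "p0 \<in> frontier G" by blast
  have "\<forall>\<^sub>F w in at p0. F w \<noteq> 0 \<and> w \<in> unit_disk"
    using holF p0(1) \<phi>0 F0 by (intro non_zero_neighbour_alt[of F unit_disk p0 "\<phi> 0"]) auto
  moreover have "\<exists>\<^sub>F w in at p0. w \<in> frontier G"
    using islimpt_frontier_simply_connected[OF \<open>open G\<close> \<open>simply_connected G\<close> p0(2)]
    by (simp add: islimpt_conv_frequently_at)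
  \<comment> \<open>Where \<open>F\<close> does not vanish, \<open>h\<close> has no pole and is locally invertible.\<close>
  ultimately have "\<exists>\<^sub>F w in at p0. (F w \<noteq> 0 \<and> w \<in> unit_disk) \<and> w \<in> frontier G"
    by (rule frequently_eventually_conj[rotated])
  then obtain p where p: "p \<in> frontier G" "F p \<noteq> 0" "p \<in> unit_disk"
    using frequently_ex by blast
  hence pV: "p \<in> V" by (auto simp: V_def F_def)
  have "deriv h p \<noteq> 0"
    using DERIV_imp_deriv[OF hder[OF pV]] p(2) by (simp add: F_def)
  then obtain r where r: "r > 0" "ball p r \<subseteq> V" "open (h ` ball p r)" "inj_on h (ball p r)"
    using has_complex_derivative_locally_invertible[OF holh pV \<open>open V\<close>] by metis
  have holhr: "h holomorphic_on ball p r"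
    using holh r(2) by (rule holomorphic_on_subset)
  obtain k where k: "k holomorphic_on h ` ball p r" "\<And>w. w \<in> ball p r \<Longrightarrow> k (h w) = w"
    using holomorphic_has_inverse[OF holhr open_ball r(4)] by metis
  have "isCont h p"
    using hder[OF pV] by (rule DERIV_isCont)
  have \<zeta>: "h p \<in> sphere 0 1"
    using left_inverse_maps_frontier_to_frontier[OF open_ball cont _ _ \<open>isCont h p\<close>] \<open>open G\<close> p(1) h\<phi>
    by (simp add: G_def)
  obtain \<rho> where \<rho>: "\<rho> > 0" "ball (h p) \<rho> \<subseteq> h ` ball p r"
    using r(1) openE[OF r(3), of "h p"] by auto
  have kV: "k z \<in> V" if "z \<in> ball (h p) \<rho>" for z
  proof -
    from that \<rho>(2) obtain w where "w \<in> ball p r" "z = h w" by blast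
    thus ?thesis using k(2) r(2) by auto
  qed
  define U where "U = (ball (h p) \<rho> \<inter> unit_disk) \<inter> \<phi> -` ball p r"
  have "open U"
    unfolding U_def by (intro continuous_open_preimage continuous_on_subset[OF cont]) auto
  have "U \<noteq> {}"
  proof -
    have "open (ball p r \<inter> h -` ball (h p) \<rho>)"
      using holhr by (intro continuous_open_preimage holomorphic_on_imp_continuous_on) auto
    moreover have "p \<in> ball p r \<inter> h -` ball (h p) \<rho>"
      using r(1) \<rho>(1) by simp
    moreover have "p \<in> closure G"
      using p(1) by (simp add: frontier_def)
    ultimately obtain w where "w \<in> G" "w \<in> ball p r" "h w \<in> ball (h p) \<rho>"
      using closure_iff_nhds_not_empty[of p G] by blast
    then obtain z where "z \<in> unit_disk" "\<phi> z \<in> ball p r" "h (\<phi> z) \<in> ball (h p) \<rho>"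
      by (auto simp: G_def)
    thus ?thesis using h\<phi>[of z] by (auto simp: U_def)
  qed
  have "\<phi> z = k z" if "z \<in> ball (h p) \<rho> \<inter> unit_disk" for z
  proof (rule analytic_continuation_open[where f = \<phi> and g = k and s = U])
    show "connected (ball (h p) \<rho> \<inter> unit_disk)"
      by (intro convex_connected convex_Int convex_ball)
    show "\<phi> holomorphic_on ball (h p) \<rho> \<inter> unit_disk"
      using hol(1) by (rule holomorphic_on_subset) auto
    show "k holomorphic_on ball (h p) \<rho> \<inter> unit_disk"
      using k(1) by (rule holomorphic_on_subset) (use \<rho>(2) in auto)
    show "\<phi> z = k z" if "z \<in> U" for z
      using that h\<phi>[of z] k(2)[of "\<phi> z"] by (auto simp: U_def)
  qed (use that \<open>open U\<close> \<open>U \<noteq> {}\<close> in \<open>auto simp: U_def\<close>)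
  moreover have "k holomorphic_on ball (h p) \<rho>"
    using k(1) \<rho>(2) by (rule holomorphic_on_subset)
  ultimately show ?thesis
    using that[OF \<zeta> \<rho>(1), of k] kV by (auto simp: V_def)
qed

section \<open>Invertible weighted composition operators\<close>

lemma extends_analytically_nearI:
  assumes "f holomorphic_on unit_disk" "g holomorphic_on B" "open B" "\<zeta> \<in> B"
    and "\<And>z. z \<in> unit_disk \<Longrightarrow> z \<in> B \<Longrightarrow> f z = g z"
  shows "extends_analytically_near f \<zeta>"
proof -
  define F where "F z = (if z \<in> unit_disk then f z else g z)" for z
  obtain r where r: "r > 0" "ball \<zeta> r \<subseteq> B"
    using assms(3,4) open_contains_ball_eq by blast
  have "F holomorphic_on (unit_disk \<union> B)"
    unfolding F_def using assms by (intro holomorphic_on_If_Un) auto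
  hence "F analytic_on (unit_disk \<union> ball \<zeta> r)"
    using r(2) assms(3) by (subst analytic_on_open) (auto elim: holomorphic_on_subset)
  thus ?thesis
    unfolding extends_analytically_near_def using r(1) by (intro exI[of _ r] conjI exI[of _ F]) (auto simp: F_def)
qed

theorem theorem2p2:
  fixes \<psi> \<phi> :: "complex \<Rightarrow> complex" and X :: "(complex \<Rightarrow> complex) set"
  assumes "\<psi> analytic_on unit_disk"
    and "\<phi> analytic_on unit_disk"
    and "\<phi> ` unit_disk \<subseteq> unit_disk"
    and "X \<subseteq> analytic_functions"
    and "weighted_comp \<psi> \<phi> ` X \<subseteq> X"
    and "\<exists>a. a \<noteq> 0 \<and> (\<lambda>z\<in>unit_disk. a) \<in> X"
    and "\<exists>c. (\<lambda>z\<in>unit_disk. z + c) \<in> X"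
    and "\<exists>S. S \<subseteq> sphere 0 1 \<and> sphere 0 1 \<subseteq> closure S \<and>
           (\<forall>\<zeta>\<in>S. \<exists>f\<in>X. \<not> extends_analytically_near f \<zeta>)"
    and "bij_betw (weighted_comp \<psi> \<phi>) X X"
  shows "disk_automorphism \<phi>"
proof -
  have onto: "\<exists>g\<in>X. \<forall>z\<in>unit_disk. f z = \<psi> z * g (\<phi> z)" if "f \<in> X" for f
  proof -
    from assms(9) that obtain g where "g \<in> X" "f = weighted_comp \<psi> \<phi> g"
      unfolding bij_betw_def by blast
    thus ?thesis by (auto simp: weighted_comp_def)
  qed
  have holX: "f holomorphic_on unit_disk" if "f \<in> X" for f
    using that assms(4) by (auto simp: analytic_functions_def analytic_imp_holomorphic)
  have hol\<phi>: "\<phi> holomorphic_on unit_disk"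
    using assms(2) by (rule analytic_imp_holomorphic)
  obtain a where a: "a \<noteq> 0" "(\<lambda>z\<in>unit_disk. a) \<in> X" using assms(6) by blast
  obtain c where c: "(\<lambda>z\<in>unit_disk. z + c) \<in> X" using assms(7) by blast
  obtain f1 where f1: "f1 \<in> X" "\<And>z. z \<in> unit_disk \<Longrightarrow> \<psi> z * f1 (\<phi> z) = a"
    using onto[OF a(2)] by force
  obtain f2 where f2: "f2 \<in> X" "\<And>z. z \<in> unit_disk \<Longrightarrow> \<psi> z * f2 (\<phi> z) = z + c"
    using onto[OF c] by force
  define P where "P = (\<lambda>w. a * f2 w - c * f1 w)"
  have holP: "P holomorphic_on unit_disk"
    unfolding P_def using holX f1(1) f2(1) by (intro holomorphic_intros) auto
  have nz: "f1 (\<phi> z) \<noteq> 0" "\<psi> z \<noteq> 0" if "z \<in> unit_disk" for z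
    using f1(2)[OF that] a(1) by auto
  have P: "P (\<phi> z) = z * f1 (\<phi> z)" if "z \<in> unit_disk" for z
  proof -
    have "\<psi> z * P (\<phi> z) = a * (\<psi> z * f2 (\<phi> z)) - c * (\<psi> z * f1 (\<phi> z))"
      by (simp add: P_def algebra_simps)
    also have "\<dots> = z * a"
      using f1(2)[OF that] f2(2)[OF that] by (simp add: algebra_simps)
    also have "\<dots> = \<psi> z * (z * f1 (\<phi> z))"
      using f1(2)[OF that] by (simp add: mult_ac)
    finally show ?thesis using nz(2)[OF that] by simp
  qed
  have inj: "inj_on \<phi> unit_disk"
    by (rule inj_onI) (metis P nz(1) mult_right_cancel)
  have "\<phi> ` unit_disk = unit_disk"
  proof (rule ccontr)
    assume "\<phi> ` unit_disk \<noteq> unit_disk"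
    then obtain \<zeta> \<rho> k where k: "\<zeta> \<in> sphere 0 1" "\<rho> > 0" "k holomorphic_on ball \<zeta> \<rho>"
      "\<And>z. z \<in> ball \<zeta> \<rho> \<Longrightarrow> k z \<in> unit_disk" "\<And>z. z \<in> ball \<zeta> \<rho> \<Longrightarrow> f1 (k z) \<noteq> 0"
      "\<And>z. z \<in> ball \<zeta> \<rho> \<inter> unit_disk \<Longrightarrow> \<phi> z = k z"
      using analytic_continuation_if_not_onto_disk[OF hol\<phi> holP holX[OF f1(1)] assms(3) _ nz(1) P]
      by metis
    have ext: "extends_analytically_near f \<xi>" if f: "f \<in> X" and \<xi>: "\<xi> \<in> ball \<zeta> \<rho>" for f \<xi>
    proof -
      obtain g where g: "g \<in> X" "\<And>z. z \<in> unit_disk \<Longrightarrow> f z = \<psi> z * g (\<phi> z)"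
        using onto[OF f] by blast
      have holk: "(\<lambda>z. u (k z)) holomorphic_on ball \<zeta> \<rho>" if "u \<in> X" for u
      proof -
        have "k ` ball \<zeta> \<rho> \<subseteq> unit_disk" using k(4) by (rule image_subsetI)
        with holomorphic_on_compose_gen[OF k(3) holX[OF that]] show ?thesis
          by (simp only: o_def)
      qed
      have "(\<lambda>z. a * g (k z) / f1 (k z)) holomorphic_on ball \<zeta> \<rho>"
        using holk[OF g(1)] holk[OF f1(1)] k(5) by (intro holomorphic_intros) auto
      moreover have "f z = a * g (k z) / f1 (k z)" if "z \<in> unit_disk" "z \<in> ball \<zeta> \<rho>" for z
        using f1(2)[OF that(1)] g(2)[OF that(1)] nz(1)[OF that(1)] k(6)[of z] that
        by (auto simp: field_simps)
      ultimately show ?thesis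
        using \<xi> by (intro extends_analytically_nearI[OF holX[OF f] _ open_ball])
    qed
    obtain S where S: "sphere 0 1 \<subseteq> closure S"
      "\<And>\<xi>. \<xi> \<in> S \<Longrightarrow> \<exists>f\<in>X. \<not> extends_analytically_near f \<xi>"
      using assms(8) by blast
    have "\<zeta> \<in> closure S" using S(1) k(1) by blast
    then obtain \<xi> where "\<xi> \<in> S" "\<xi> \<in> ball \<zeta> \<rho>"
      using k(2) closure_approachable[of \<zeta> S] by (auto simp: dist_commute)
    thus False using S(2) ext by blast
  qed
  with inj assms(2) show ?thesis
    by (simp add: disk_automorphism_def bij_betw_def)
qed

end
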